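(* Let $\eta_1=\eta_1(R^1)$, $\eta_2=\eta_2(R^2)$ be functions of one variable, and consider the nonlinear system for functions $H_1,H_2,\beta_{12},\beta_{21}$ of $(R^1,R^2)$: $$\partial_1H_2=\beta_{12}H_1,\qquad \partial_2H_1=\beta_{21}H_2,$$ $$\partial_1\beta_{12}+\partial_2\beta_{21}=0,$$ $$\eta_1\partial_1\beta_{12}+\eta_2\partial_2\beta_{21}+\tfrac12\eta_1'\beta_{12}+\tfrac12\eta_2'\beta_{21}+H_1H_2=0 .$$ This system possesses the following Lax pair with spectral parameter $\lambda$: it is the compatibility condition (for all $\lambda$) of the linear system $$\partial_1\psi=\begin{pmatrix}0&-\sqrt{\frac{\lambda+\eta_2}{\lambda+\eta_1}}\,\beta_{21}&\frac{H_1}{\sqrt{\lambda+\eta_1}}\\ \sqrt{\frac{\lambda+\eta_2}{\lambda+\eta_1}}\,\beta_{21}&0&0\\ -\frac{H_1}{\sqrt{\lambda+\eta_1}}&0&0\end{pmatrix}\psi,$$ $$\partial_2\psi=\begin{pmatrix}0&\sqrt{\frac{\lambda+\eta_1}{\lambda+\eta_2}}\,\beta_{12}&0\\ -\sqrt{\frac{\lambda+\eta_1}{\lambda+\eta_2}}\,\beta_{12}&0&\frac{H_2}{\sqrt{\lambda+\eta_2}}\\ 0&-\frac{H_2}{\sqrt{\lambda+\eta_2}}&0\end{pmatrix}\psi .$$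
   Context: Here $\partial_i=\partial/\partial R^i$, $\eta_i'=d\eta_i/dR^i$, and $\lambda$ ranges over values with $\lambda+\eta_1>0$ and $\lambda+\eta_2>0$. "Compatibility condition (for all $\lambda$)" means: writing the linear system as $\partial_1\psi=U\psi$, $\partial_2\psi=V\psi$, the zero-curvature equation $\partial_2U-\partial_1V+UV-VU=0$ holds for all such $\lambda$ if and only if $H_1,H_2,\beta_{12},\beta_{21}$ satisfy the nonlinear system. *)

theory Defs
  imports "HOL-Analysis.Analysis"
begin

text \<open>
  The independent variables \<open>(R\<^sup>1, R\<^sup>2)\<close> form a pair of reals. The partial derivatives are
  used both for scalar and for matrix-valued functions; on reals \<open>vector_derivative\<close> is
  the ordinary derivative.
\<close>

definition pd1 :: "(real \<times> real \<Rightarrow> 'a::real_normed_vector) \<Rightarrow> real \<times> real \<Rightarrow> 'a" where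
  "pd1 f p = vector_derivative (\<lambda>t. f (t, snd p)) (at (fst p))"

definition pd2 :: "(real \<times> real \<Rightarrow> 'a::real_normed_vector) \<Rightarrow> real \<times> real \<Rightarrow> 'a" where
  "pd2 f p = vector_derivative (\<lambda>t. f (fst p, t)) (at (snd p))"

definition nonlinear_system ::
  "(real \<times> real) set \<Rightarrow> (real \<Rightarrow> real) \<Rightarrow> (real \<Rightarrow> real) \<Rightarrow>
   (real \<times> real \<Rightarrow> real) \<Rightarrow> (real \<times> real \<Rightarrow> real) \<Rightarrow>
   (real \<times> real \<Rightarrow> real) \<Rightarrow> (real \<times> real \<Rightarrow> real) \<Rightarrow> bool" where
  "nonlinear_system D \<eta>1 \<eta>2 H1 H2 \<beta>12 \<beta>21 \<longleftrightarrow>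
    (\<forall>p\<in>D.
       pd1 H2 p = \<beta>12 p * H1 p \<and>
       pd2 H1 p = \<beta>21 p * H2 p \<and>
       pd1 \<beta>12 p + pd2 \<beta>21 p = 0 \<and>
       \<eta>1 (fst p) * pd1 \<beta>12 p + \<eta>2 (snd p) * pd2 \<beta>21 p
         + 1/2 * deriv \<eta>1 (fst p) * \<beta>12 p + 1/2 * deriv \<eta>2 (snd p) * \<beta>21 p
         + H1 p * H2 p = 0)"

definition lax_U ::
  "(real \<Rightarrow> real) \<Rightarrow> (real \<Rightarrow> real) \<Rightarrow> (real \<times> real \<Rightarrow> real) \<Rightarrow> (real \<times> real \<Rightarrow> real) \<Rightarrow>
   real \<Rightarrow> real \<times> real \<Rightarrow> real^3^3" where
  "lax_U \<eta>1 \<eta>2 H1 \<beta>21 lam p =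
    (let a = sqrt ((lam + \<eta>2 (snd p)) / (lam + \<eta>1 (fst p))) * \<beta>21 p;
         h = H1 p / sqrt (lam + \<eta>1 (fst p))
     in vector [vector [0, - a, h],
                vector [a, 0, 0],
                vector [- h, 0, 0]])"

definition lax_V ::
  "(real \<Rightarrow> real) \<Rightarrow> (real \<Rightarrow> real) \<Rightarrow> (real \<times> real \<Rightarrow> real) \<Rightarrow> (real \<times> real \<Rightarrow> real) \<Rightarrow>
   real \<Rightarrow> real \<times> real \<Rightarrow> real^3^3" where
  "lax_V \<eta>1 \<eta>2 H2 \<beta>12 lam p =
    (let b = sqrt ((lam + \<eta>1 (fst p)) / (lam + \<eta>2 (snd p))) * \<beta>12 p;
         h = H2 p / sqrt (lam + \<eta>2 (snd p))
     in vector [vector [0, b, 0],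
                vector [- b, 0, h],
                vector [0, - h, 0]])"

text \<open>
  Zero-curvature form, at the point \<open>p\<close>, of the compatibility condition of the linear system
  \<open>pd1 \<psi> = U *v \<psi>\<close>, \<open>pd2 \<psi> = V *v \<psi>\<close>. It is meant for \<open>U\<close>, \<open>V\<close> whose partial derivatives
  exist at \<open>p\<close>.
\<close>

definition zero_curvature ::
  "(real \<times> real \<Rightarrow> real^3^3) \<Rightarrow> (real \<times> real \<Rightarrow> real^3^3) \<Rightarrow> real \<times> real \<Rightarrow> bool" where
  "zero_curvature U V p \<longleftrightarrow> pd2 U p - pd1 V p + U p ** V p - V p ** U p = 0"

end

theory Submission
  imports Defs
begin

text \<open>
  Both Lax matrices are skew-symmetric, so the zero-curvature equation lives in the
  three-dimensional Lie algebra \<open>so(3)\<close> and amounts to three scalar equations. Write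
  \<open>s1 = sqrt (\<lambda> + \<eta>1)\<close> and \<open>s2 = sqrt (\<lambda> + \<eta>2)\<close>. The factors \<open>s1\<close> and \<open>s2\<close> in the (1,3) and
  (2,3) entries of \<open>U\<close> and \<open>V\<close> depend only on the variable that is not differentiated; they
  cancel, and what remains is \<open>\<partial>2 H1 = \<beta>21 H2\<close> and \<open>\<partial>1 H2 = \<beta>12 H1\<close>. The (1,2) entry,
  multiplied by \<open>- s1 s2\<close>, is the expression
  \<open>\<lambda> (\<partial>1 \<beta>12 + \<partial>2 \<beta>21)
    + (\<eta>1 \<partial>1 \<beta>12 + \<eta>2 \<partial>2 \<beta>21 + \<eta>1' \<beta>12 / 2 + \<eta>2' \<beta>21 / 2 + H1 H2)\<close>,
  which is affine in \<open>\<lambda>\<close> (lemma \<open>zero_curvature_lax_iff\<close>). At a fixed point the admissible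
  \<open>\<lambda>\<close> form a half-line, so it vanishes for all of them exactly when both of its
  coefficients do (lemma \<open>affine_vanishes_iff\<close>), and these are the two remaining equations of the
  nonlinear system.
\<close>

definition skew3 :: "real \<Rightarrow> real \<Rightarrow> real \<Rightarrow> real^3^3" where
  "skew3 x y z = vector [vector [0, x, y], vector [- x, 0, z], vector [- y, - z, 0]]"

lemma skew3_eq_iff: "skew3 x y z = skew3 x' y' z' \<longleftrightarrow> x = x' \<and> y = y' \<and> z = z'"
  by (auto simp: skew3_def vec_eq_iff forall_3)

lemma skew3_zero: "skew3 0 0 0 = 0"
  by (simp add: skew3_def vec_eq_iff forall_3)

lemma skew3_diff: "skew3 x y z - skew3 x' y' z' = skew3 (x - x') (y - y') (z - z')"
  by (simp add: skew3_def vec_eq_iff forall_3)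

lemma skew3_add: "skew3 x y z + skew3 x' y' z' = skew3 (x + x') (y + y') (z + z')"
  by (simp add: skew3_def vec_eq_iff forall_3)

lemma skew3_commutator:
  "skew3 x y z ** skew3 x' y' z' - skew3 x' y' z' ** skew3 x y z
    = skew3 (z * y' - y * z') (x * z' - z * x') (y * x' - x * y')"
  by (simp add: skew3_def matrix_matrix_mult_def vec_eq_iff forall_3 sum_3)

text \<open>
  Linearity of \<open>skew3\<close> in its three entries reduces matrix differentiation to scalar
  differentiation.
\<close>

lemma skew3_decompose:
  "skew3 x y z = x *\<^sub>R skew3 1 0 0 + y *\<^sub>R skew3 0 1 0 + z *\<^sub>R skew3 0 0 1"
  by (simp add: skew3_def vec_eq_iff forall_3)

lemma has_vector_derivative_skew3:
  assumes "(f has_real_derivative f') (at t)" "(g has_real_derivative g') (at t)"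
    "(h has_real_derivative h') (at t)"
  shows "((\<lambda>t. skew3 (f t) (g t) (h t)) has_vector_derivative skew3 f' g' h') (at t)"
proof -
  have scale: "((\<lambda>t. k t *\<^sub>R M) has_vector_derivative k' *\<^sub>R M) (at t)"
    if "(k has_real_derivative k') (at t)" for k k' and M :: "real^3^3"
    using has_vector_derivative_scaleR[OF that has_vector_derivative_const[of M]] by simp
  have "((\<lambda>t. f t *\<^sub>R skew3 1 0 0 + g t *\<^sub>R skew3 0 1 0 + h t *\<^sub>R skew3 0 0 1)
      has_vector_derivative f' *\<^sub>R skew3 1 0 0 + g' *\<^sub>R skew3 0 1 0 + h' *\<^sub>R skew3 0 0 1) (at t)"
    by (rule has_vector_derivative_add scale assms)+
  then show ?thesis by (simp only: skew3_decompose[symmetric])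
qed

lemma lax_U_skew3:
  "lax_U \<eta>1 \<eta>2 H1 \<beta>21 lam p =
    skew3 (- (sqrt ((lam + \<eta>2 (snd p)) / (lam + \<eta>1 (fst p))) * \<beta>21 p))
      (H1 p / sqrt (lam + \<eta>1 (fst p))) 0"
  by (simp add: lax_U_def skew3_def Let_def)

lemma lax_V_skew3:
  "lax_V \<eta>1 \<eta>2 H2 \<beta>12 lam p =
    skew3 (sqrt ((lam + \<eta>1 (fst p)) / (lam + \<eta>2 (snd p))) * \<beta>12 p)
      0 (H2 p / sqrt (lam + \<eta>2 (snd p)))"
  by (simp add: lax_V_def skew3_def Let_def)

lemma has_derivative_pd1:
  assumes "f differentiable (at p)"
  shows "((\<lambda>t. f (t, snd p)) has_vector_derivative pd1 f p) (at (fst p))"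
proof -
  have "f differentiable (at ((\<lambda>t. (t, snd p)) (fst p)))" using assms by simp
  then have "(\<lambda>t. f (t, snd p)) differentiable (at (fst p))"
    using differentiable_compose[of f "\<lambda>t. (t, snd p)" "fst p" UNIV]
    by (simp add: differentiable_Pair)
  then show ?thesis unfolding pd1_def by (simp add: vector_derivative_works)
qed

lemma has_derivative_pd2:
  assumes "f differentiable (at p)"
  shows "((\<lambda>t. f (fst p, t)) has_vector_derivative pd2 f p) (at (snd p))"
proof -
  have "f differentiable (at ((\<lambda>t. (fst p, t)) (snd p)))" using assms by simp
  then have "(\<lambda>t. f (fst p, t)) differentiable (at (snd p))"
    using differentiable_compose[of f "\<lambda>t. (fst p, t)" "snd p" UNIV]
    by (simp add: differentiable_Pair)
  then show ?thesis unfolding pd2_def by (simp add: vector_derivative_works)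
qed

text \<open>
  Covers the (1,2) entries of both \<open>U\<close> and \<open>V\<close>: the variable being differentiated occurs in the
  numerator under the root, while the denominator \<open>c\<close> is constant along the line.
\<close>

lemma has_real_derivative_sqrt_ratio_mult:
  assumes e: "(e has_real_derivative e') (at t)" and f: "(f has_real_derivative f') (at t)"
    and pos: "lam + e t > 0" "c > 0"
  shows "((\<lambda>t. sqrt ((lam + e t) / c) * f t) has_real_derivative
    (((lam + e t) * f' + e' * f t / 2) / (sqrt (lam + e t) * sqrt c))) (at t)"
proof -
  define r where "r = sqrt (lam + e t)"
  have r: "r > 0" "lam + e t = r * r" using pos by (auto simp: r_def)
  have "((\<lambda>t. lam + e t) has_real_derivative e') (at t)"
    using DERIV_add[OF DERIV_const[of lam] e] by simp
  from DERIV_chain2[OF DERIV_real_sqrt[OF pos(1)] this]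
  have "((\<lambda>t. sqrt (lam + e t)) has_real_derivative inverse r / 2 * e') (at t)"
    unfolding r_def .
  from DERIV_mult[OF DERIV_cdivide[OF this, of "sqrt c"] f]
  have "((\<lambda>t. sqrt (lam + e t) / sqrt c * f t) has_real_derivative
     (inverse r / 2 * e' / sqrt c * f t + f' * (r / sqrt c))) (at t)"
    unfolding r_def .
  moreover have "inverse r / 2 * e' / sqrt c * f t + f' * (r / sqrt c)
     = ((r * r) * f' + e' * f t / 2) / (r * sqrt c)"
    using pos r(1) by (simp add: field_simps)
  ultimately show ?thesis using pos by (simp add: real_sqrt_divide r_def)
qed

text \<open>
  The pointwise computation at one value of \<open>\<lambda>\<close>. The last equation is the (1,2) entry after
  multiplying by \<open>- sqrt (\<lambda> + \<eta>1) * sqrt (\<lambda> + \<eta>2)\<close> and sorting by powers of \<open>\<lambda>\<close>.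
\<close>

lemma zero_curvature_lax_iff:
  fixes p :: "real \<times> real"
  assumes \<eta>: "\<eta>1 differentiable (at (fst p))" "\<eta>2 differentiable (at (snd p))"
    and H: "H1 differentiable (at p)" "H2 differentiable (at p)"
    and \<beta>: "\<beta>12 differentiable (at p)" "\<beta>21 differentiable (at p)"
    and pos: "lam + \<eta>1 (fst p) > 0" "lam + \<eta>2 (snd p) > 0"
  shows "zero_curvature (lax_U \<eta>1 \<eta>2 H1 \<beta>21 lam) (lax_V \<eta>1 \<eta>2 H2 \<beta>12 lam) p \<longleftrightarrow>
    pd1 H2 p = \<beta>12 p * H1 p \<and> pd2 H1 p = \<beta>21 p * H2 p \<and>
    lam * (pd1 \<beta>12 p + pd2 \<beta>21 p)
      + (\<eta>1 (fst p) * pd1 \<beta>12 p + \<eta>2 (snd p) * pd2 \<beta>21 p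
         + 1/2 * deriv \<eta>1 (fst p) * \<beta>12 p + 1/2 * deriv \<eta>2 (snd p) * \<beta>21 p
         + H1 p * H2 p) = 0"
proof -
  define s1 where "s1 = sqrt (lam + \<eta>1 (fst p))"
  define s2 where "s2 = sqrt (lam + \<eta>2 (snd p))"
  define a' where "a' = ((lam + \<eta>2 (snd p)) * pd2 \<beta>21 p + deriv \<eta>2 (snd p) * \<beta>21 p / 2) / (s2 * s1)"
  define b' where "b' = ((lam + \<eta>1 (fst p)) * pd1 \<beta>12 p + deriv \<eta>1 (fst p) * \<beta>12 p / 2) / (s1 * s2)"
  have s: "s1 > 0" "s2 > 0" using pos by (auto simp: s1_def s2_def)
  have d\<eta>: "(\<eta>1 has_real_derivative deriv \<eta>1 (fst p)) (at (fst p))"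
    "(\<eta>2 has_real_derivative deriv \<eta>2 (snd p)) (at (snd p))"
    using \<eta> by (auto simp: DERIV_deriv_iff_real_differentiable)
  have d\<beta>21: "((\<lambda>t. \<beta>21 (fst p, t)) has_real_derivative pd2 \<beta>21 p) (at (snd p))"
    and dH1: "((\<lambda>t. H1 (fst p, t)) has_real_derivative pd2 H1 p) (at (snd p))"
    and d\<beta>12: "((\<lambda>t. \<beta>12 (t, snd p)) has_real_derivative pd1 \<beta>12 p) (at (fst p))"
    and dH2: "((\<lambda>t. H2 (t, snd p)) has_real_derivative pd1 H2 p) (at (fst p))"
    unfolding has_real_derivative_iff_has_vector_derivative
    by (rule has_derivative_pd1 has_derivative_pd2 H \<beta>)+
  have "((\<lambda>t. lax_U \<eta>1 \<eta>2 H1 \<beta>21 lam (fst p, t)) has_vector_derivative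
      skew3 (- a') (pd2 H1 p / s1) 0) (at (snd p))"
    unfolding lax_U_skew3 fst_conv snd_conv s1_def
    using has_real_derivative_sqrt_ratio_mult[OF d\<eta>(2) d\<beta>21 pos(2) pos(1)]
    by (intro has_vector_derivative_skew3 DERIV_minus DERIV_cdivide dH1 DERIV_const)
       (simp add: a'_def s1_def s2_def)
  then have U: "pd2 (lax_U \<eta>1 \<eta>2 H1 \<beta>21 lam) p = skew3 (- a') (pd2 H1 p / s1) 0"
    unfolding pd2_def[of "lax_U _ _ _ _ _"] by (rule vector_derivative_at)
  have "((\<lambda>t. lax_V \<eta>1 \<eta>2 H2 \<beta>12 lam (t, snd p)) has_vector_derivative
      skew3 b' 0 (pd1 H2 p / s2)) (at (fst p))"
    unfolding lax_V_skew3 fst_conv snd_conv s2_def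
    using has_real_derivative_sqrt_ratio_mult[OF d\<eta>(1) d\<beta>12 pos]
    by (intro has_vector_derivative_skew3 DERIV_cdivide dH2 DERIV_const)
       (simp add: b'_def s1_def s2_def)
  then have V: "pd1 (lax_V \<eta>1 \<eta>2 H2 \<beta>12 lam) p = skew3 b' 0 (pd1 H2 p / s2)"
    unfolding pd1_def[of "lax_V _ _ _ _ _"] by (rule vector_derivative_at)
  have Up: "lax_U \<eta>1 \<eta>2 H1 \<beta>21 lam p = skew3 (- (s2 / s1 * \<beta>21 p)) (H1 p / s1) 0"
    by (simp add: lax_U_skew3 s1_def s2_def real_sqrt_divide)
  have Vp: "lax_V \<eta>1 \<eta>2 H2 \<beta>12 lam p = skew3 (s1 / s2 * \<beta>12 p) 0 (H2 p / s2)"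
    by (simp add: lax_V_skew3 s1_def s2_def real_sqrt_divide)
  have "zero_curvature (lax_U \<eta>1 \<eta>2 H1 \<beta>21 lam) (lax_V \<eta>1 \<eta>2 H2 \<beta>12 lam) p \<longleftrightarrow>
      - a' - b' - H1 p / s1 * (H2 p / s2) = 0 \<and>
      pd2 H1 p / s1 - s2 / s1 * \<beta>21 p * (H2 p / s2) = 0 \<and>
      - (pd1 H2 p / s2) + H1 p / s1 * (s1 / s2 * \<beta>12 p) = 0"
    unfolding zero_curvature_def add_diff_eq[symmetric] U V Up Vp skew3_commutator skew3_diff skew3_add
      skew3_zero[symmetric] skew3_eq_iff
    by (simp add: algebra_simps)
  also have "pd2 H1 p / s1 - s2 / s1 * \<beta>21 p * (H2 p / s2) = 0 \<longleftrightarrow> pd2 H1 p = \<beta>21 p * H2 p"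
    using s by (simp add: field_simps)
  also have "- (pd1 H2 p / s2) + H1 p / s1 * (s1 / s2 * \<beta>12 p) = 0 \<longleftrightarrow> pd1 H2 p = \<beta>12 p * H1 p"
    using s by (auto simp: field_simps)
  also have "- a' - b' - H1 p / s1 * (H2 p / s2) =
     - (lam * (pd1 \<beta>12 p + pd2 \<beta>21 p)
      + (\<eta>1 (fst p) * pd1 \<beta>12 p + \<eta>2 (snd p) * pd2 \<beta>21 p
         + 1/2 * deriv \<eta>1 (fst p) * \<beta>12 p + 1/2 * deriv \<eta>2 (snd p) * \<beta>21 p
         + H1 p * H2 p)) / (s1 * s2)" (is "_ = - ?E / _")
    using s by (simp add: a'_def b'_def field_simps)
  also have "- ?E / (s1 * s2) = 0 \<longleftrightarrow> ?E = 0"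
    unfolding divide_eq_0_iff neg_equal_0_iff_equal using s by auto
  finally show ?thesis by blast
qed

text \<open>
  Separation of the powers of \<open>\<lambda>\<close>: any two distinct points of the half-line determine both
  coefficients.
\<close>

lemma affine_vanishes_iff:
  fixes a b m :: real
  shows "(\<forall>x>m. x * a + b = 0) \<longleftrightarrow> a = 0 \<and> b = 0"
proof
  assume *: "\<forall>x>m. x * a + b = 0"
  have "(m + 1) * a + b = 0" "(m + 2) * a + b = 0"
    using *[rule_format, of "m + 1"] *[rule_format, of "m + 2"] by auto
  moreover from this have "a = 0" by (simp add: distrib_right)
  ultimately show "a = 0 \<and> b = 0" by simp
qed auto

theorem mainTheorem5:
  fixes D :: "(real \<times> real) set"
    and \<eta>1 \<eta>2 :: "real \<Rightarrow> real"
    and H1 H2 \<beta>12 \<beta>21 :: "real \<times> real \<Rightarrow> real"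
  assumes "open D"
    and "\<eta>1 differentiable_on (fst ` D)" and "\<eta>2 differentiable_on (snd ` D)"
    and "H1 differentiable_on D" and "H2 differentiable_on D"
    and "\<beta>12 differentiable_on D" and "\<beta>21 differentiable_on D"
  shows "(\<forall>lam. \<forall>p\<in>D. lam + \<eta>1 (fst p) > 0 \<and> lam + \<eta>2 (snd p) > 0 \<longrightarrow>
            zero_curvature (lax_U \<eta>1 \<eta>2 H1 \<beta>21 lam) (lax_V \<eta>1 \<eta>2 H2 \<beta>12 lam) p)
         \<longleftrightarrow> nonlinear_system D \<eta>1 \<eta>2 H1 H2 \<beta>12 \<beta>21"
proof -
  \<comment> \<open>Both projections are open maps, so differentiability on the projected sets is pointwise.\<close>
  have op: "open (fst ` D)" "open (snd ` D)"
    using \<open>open D\<close> by (auto intro: open_image_fst open_image_snd)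
  define N where "N p \<longleftrightarrow> pd1 H2 p = \<beta>12 p * H1 p \<and> pd2 H1 p = \<beta>21 p * H2 p" for p
  define A where "A p = pd1 \<beta>12 p + pd2 \<beta>21 p" for p
  define B where "B p = \<eta>1 (fst p) * pd1 \<beta>12 p + \<eta>2 (snd p) * pd2 \<beta>21 p
         + 1/2 * deriv \<eta>1 (fst p) * \<beta>12 p + 1/2 * deriv \<eta>2 (snd p) * \<beta>21 p
         + H1 p * H2 p" for p
  define m where "m p = max (- \<eta>1 (fst p)) (- \<eta>2 (snd p))" for p
  have half_line: "lam + \<eta>1 (fst p) > 0 \<and> lam + \<eta>2 (snd p) > 0 \<longleftrightarrow> lam > m p" for lam p
    by (auto simp: m_def)
  have zc: "zero_curvature (lax_U \<eta>1 \<eta>2 H1 \<beta>21 lam) (lax_V \<eta>1 \<eta>2 H2 \<beta>12 lam) p \<longleftrightarrow>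
      N p \<and> lam * A p + B p = 0" if p: "p \<in> D" and lam: "lam > m p" for lam p
  proof -
    have "\<eta>1 differentiable (at (fst p))" "\<eta>2 differentiable (at (snd p))"
      using assms(2,3) op p by (auto simp: differentiable_on_eq_differentiable_at)
    moreover have "H1 differentiable (at p)" "H2 differentiable (at p)"
      "\<beta>12 differentiable (at p)" "\<beta>21 differentiable (at p)"
      using assms(1,4-7) p by (auto simp: differentiable_on_eq_differentiable_at)
    moreover have "lam + \<eta>1 (fst p) > 0" "lam + \<eta>2 (snd p) > 0"
      using lam half_line[of lam p] by auto
    ultimately show ?thesis
      by (simp only: N_def A_def B_def zero_curvature_lax_iff conj_assoc)
  qed
  have "(\<forall>lam. \<forall>p\<in>D. lam + \<eta>1 (fst p) > 0 \<and> lam + \<eta>2 (snd p) > 0 \<longrightarrow>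
            zero_curvature (lax_U \<eta>1 \<eta>2 H1 \<beta>21 lam) (lax_V \<eta>1 \<eta>2 H2 \<beta>12 lam) p)
    \<longleftrightarrow> (\<forall>p\<in>D. \<forall>lam>m p. N p \<and> lam * A p + B p = 0)"
    unfolding half_line using zc by blast
  also have "\<dots> \<longleftrightarrow> (\<forall>p\<in>D. N p \<and> (\<forall>lam>m p. lam * A p + B p = 0))"
    using gt_ex by blast
  also have "\<dots> \<longleftrightarrow> nonlinear_system D \<eta>1 \<eta>2 H1 H2 \<beta>12 \<beta>21"
    unfolding affine_vanishes_iff nonlinear_system_def N_def A_def B_def by (simp only: conj_assoc)
  finally show ?thesis .
qed

end
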